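(* Let $H=\{h_n\}_{n\ge1}$ be a sequence of highly composite numbers with the property that $n!\mid h_n$ for each positive integer $n$. Then the factorial set $H_{h_1}$ of $H$ is self-factorial, and for every integer $k\ge1$ the series $$\sum_{n=1}^{\infty}\frac{1}{\left\{h_1^{\lfloor n/1\rfloor}\,h_2^{\lfloor n/2\rfloor}\,h_3^{\lfloor n/3\rfloor}\cdots h_n^{\lfloor n/n\rfloor}\right\}^{k}}$$ is irrational.
   Context: A positive integer $N$ is highly composite if $d(m)<d(N)$ for every positive integer $m<N$, where $d$ is the number-of-divisors function. Given a sequence $(b_1,b_2,\dots)$ of positive integers, its factorial set (with first element $b_1$) is the sequence $B_0=1$, $B_n=\prod_{i=1}^{n}b_i^{\lfloor n/i\rfloor}$ for $n\ge1$; $H_{h_1}$ is the factorial set of $H$ with first element $h_1$. A factorial set $\{B_n\}$ is self-factorial if $n!\mid B_n$ for every $n$. *)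

theory Defs
  imports Complex_Main
begin

definition num_divisors :: "nat \<Rightarrow> nat" where
  "num_divisors n = card {d. d dvd n}"

definition highly_composite :: "nat \<Rightarrow> bool" where
  "highly_composite N \<longleftrightarrow> N > 0 \<and> (\<forall>m. 0 < m \<and> m < N \<longrightarrow> num_divisors m < num_divisors N)"

text \<open>
  A sequence \<open>(b\<^sub>1, b\<^sub>2, \<dots>)\<close> is a function on \<^typ>\<open>nat\<close> whose value at \<open>0\<close> is never used;
  its factorial set is indexed from \<open>0\<close>, the empty product giving \<open>B\<^sub>0 = 1\<close>.
\<close>

definition factorial_set :: "(nat \<Rightarrow> nat) \<Rightarrow> nat \<Rightarrow> nat" where
  "factorial_set b n = (\<Prod>i=1..n. b i ^ (n div i))"

definition self_factorial :: "(nat \<Rightarrow> nat) \<Rightarrow> bool" where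
  "self_factorial B \<longleftrightarrow> (\<forall>n. fact n dvd B n)"

end

theory Submission
  imports Defs
begin

text \<open>
  Passing from \<open>B\<^sub>n\<close> to \<open>B\<^bsub>n+1\<^esub>\<close> multiplies by the product of the \<open>h\<^sub>d\<close> over the divisors
  \<open>d\<close> of \<open>n + 1\<close>, a multiple of \<open>h\<^bsub>n+1\<^esub>\<close> and hence at least \<open>(n + 1)!\<close>. So the terms \<open>1 / B\<^sub>n\<^sup>k\<close> have
  integer denominators, each dividing the next, with quotients tending to infinity. If such a series
  had a rational sum with denominator \<open>q\<close>, then \<open>q\<close> times the denominator of a late term times the
  remaining tail would be an integer strictly between \<open>0\<close> and \<open>1\<close>.
\<close>

lemma inverse_divisor_chain_sum_irrational:
  fixes P c :: "nat \<Rightarrow> nat"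
  assumes pos: "\<And>n. P n > 0"
    and step: "\<And>n. P (Suc n) = P n * c n"
    and c_top: "filterlim c at_top sequentially"
  shows "summable (\<lambda>n. 1 / real (P n))" and "(\<Sum>n. 1 / real (P n)) \<notin> \<rat>"
proof -
  \<comment> \<open>Once every quotient \<open>c n\<close> is at least \<open>M\<close>,
    \<open>P\<close> grows at least geometrically with ratio \<open>M\<close>. Ratio 2 will give
    summability; a ratio depending on the denominator of the sum will give irrationality.\<close>
  have growth: "\<exists>N. \<forall>n. P N * M ^ n \<le> P (n + N)" for M
  proof -
    obtain N where N: "\<And>n. n \<ge> N \<Longrightarrow> M \<le> c n"
      using c_top unfolding filterlim_at_top eventually_sequentially by blast
    have "P N * M ^ n \<le> P (n + N)" for n
    proof (induction n)
      case (Suc n)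
      have "P N * M ^ Suc n = (P N * M ^ n) * M" by simp
      also have "\<dots> \<le> P (n + N) * c (n + N)"
        by (intro mult_le_mono Suc N) simp
      finally show ?case by (simp add: step)
    qed simp
    then show ?thesis by blast
  qed
  have tail_le: "1 / real (P (n + N)) \<le> 1 / real (P N) * (1 / real M) ^ n"
    if "\<forall>n. P N * M ^ n \<le> P (n + N)" "M > 0" for M N n
  proof -
    have "real (P N) * real M ^ n \<le> real (P (n + N))"
      using that(1) by (metis of_nat_le_iff of_nat_mult of_nat_power)
    then have "1 / real (P (n + N)) \<le> 1 / (real (P N) * real M ^ n)"
      using pos[of N] that(2) by (intro divide_left_mono mult_pos_pos) (auto simp: pos)
    then show ?thesis by (simp add: power_divide)
  qed
  show summ: "summable (\<lambda>n. 1 / real (P n))"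
  proof -
    obtain N where "\<forall>n. P N * 2 ^ n \<le> P (n + N)" using growth by blast
    from tail_le[OF this]
    have le: "1 / real (P (n + N)) \<le> 1 / real (P N) * (1 / 2) ^ n" for n by simp
    have "summable (\<lambda>n. 1 / real (P N) * (1 / 2) ^ n)"
      by (rule summable_mult) (simp add: summable_geometric)
    then have "summable (\<lambda>n. 1 / real (P (n + N)))"
      by (rule summable_comparison_test'[where N = 0]) (use le in simp)
    then show ?thesis by (subst (asm) summable_iff_shift)
  qed
  show "(\<Sum>n. 1 / real (P n)) \<notin> \<rat>"
  proof
    assume "(\<Sum>n. 1 / real (P n)) \<in> \<rat>"
    then obtain a b :: int where b: "b > 0" and S: "(\<Sum>n. 1 / real (P n)) = of_int a / of_int b"
      by (elim Rats_cases') auto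
    \<comment> \<open>With ratio 1/\<open>M\<close>, the tail after index \<open>N\<close>, scaled
      by \<open>P N\<close>, is at most 1/(\<open>M\<close> - 1) = 1/(\<open>b\<close> + 1), so
      multiplying it by \<open>b\<close> still leaves a number below 1.\<close>
    define M where "M = nat b + 2"
    obtain N where N: "\<forall>n. P N * M ^ n \<le> P (n + N)" using growth by blast
    \<comment> \<open>The tail starts at \<open>Suc N\<close>: the term of index \<open>N\<close>
      stays in the head, whose denominators all divide \<open>P N\<close>. Hence also the exponent
      \<open>Suc n\<close> in the geometric majorant.\<close>
    define T where "T = (\<Sum>n. 1 / real (P (n + Suc N)))"
    have summT: "summable (\<lambda>n. 1 / real (P (n + Suc N)))"
      using summ by (subst summable_iff_shift)
    have T_pos: "T > 0"
      unfolding T_def by (intro suminf_pos summT) (simp add: pos)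
    have geo: "(\<lambda>n. 1 / real (P N) * (1 / real M) ^ Suc n) sums
        (1 / real (P N) * (1 / real M / (1 - 1 / real M)))"
    proof -
      have "(\<lambda>n. (1 / real M) ^ n) sums (1 / (1 - 1 / real M))"
        by (rule geometric_sums) (simp add: M_def)
      from sums_mult[OF this, of "1 / real (P N) * (1 / real M)"]
      show ?thesis by (simp add: mult.assoc)
    qed
    have "T \<le> (\<Sum>n. 1 / real (P N) * (1 / real M) ^ Suc n)"
      unfolding T_def
    proof (intro suminf_le summT sums_summable[OF geo])
      show "1 / real (P (n + Suc N)) \<le> 1 / real (P N) * (1 / real M) ^ Suc n" for n
        using tail_le[OF N, of "Suc n"] by (simp add: M_def)
    qed
    also have "\<dots> = 1 / real (P N) * (1 / real M / (1 - 1 / real M))"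
      by (rule sums_unique[OF geo, symmetric])
    also have "1 / real M / (1 - 1 / real M) = 1 / (of_int b + 1)"
      using b by (simp add: M_def field_simps)
    finally have "real (P N) * T \<le> real (P N) * (1 / real (P N) * (1 / (of_int b + 1)))"
      by (intro mult_left_mono) auto
    then have T_le: "real (P N) * T \<le> 1 / (of_int b + 1)"
      using pos[of N] by simp
    have "of_int b * (real (P N) * T) \<le> of_int b * (1 / (of_int b + 1))"
      using b by (intro mult_left_mono T_le) auto
    also have "\<dots> < 1" using b by (simp add: field_simps)
    finally have less_1: "of_int b * real (P N) * T < 1" by (simp add: mult.assoc)
    have gr_0: "of_int b * real (P N) * T > 0"
      using b T_pos pos[of N] by simp
    have dvd: "P n dvd P m" if "n \<le> m" for n m
      using that by (induction rule: dec_induct) (auto simp: step)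
    \<comment> \<open>Each \<open>P n\<close> with n \<le> N divides \<open>P N\<close>, so the
      natural-number quotients are exact and the scaled head is an integer.\<close>
    have head: "real (P N) * (\<Sum>n<Suc N. 1 / real (P n)) = of_int (\<Sum>n<Suc N. int (P N div P n))"
      by (simp add: sum_distrib_left real_of_nat_div dvd del: sum.lessThan_Suc)
    have "of_int a / of_int b = T + (\<Sum>n<Suc N. 1 / real (P n))"
      using suminf_split_initial_segment[OF summ, of "Suc N"] S by (simp add: T_def)
    then have "of_int b * real (P N) * (T + (\<Sum>n<Suc N. 1 / real (P n))) = of_int a * real (P N)"
      using b by (simp add: field_simps)
    then have "of_int b * real (P N) * T =
        of_int a * real (P N) - of_int b * (real (P N) * (\<Sum>n<Suc N. 1 / real (P n)))"
      by (simp only: algebra_simps)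
    also have "\<dots> = of_int (a * int (P N) - b * (\<Sum>n<Suc N. int (P N div P n)))"
      unfolding head by simp
    finally obtain z :: int where "of_int b * real (P N) * T = of_int z" by blast
    with gr_0 less_1 show False by simp
  qed
qed

text \<open>Passing from n to n + 1 raises \<lfloor>n/i\<rfloor> by one exactly when i divides n +
  1, and leaves it unchanged otherwise.\<close>

lemma factorial_set_Suc:
  "factorial_set b (Suc n) = factorial_set b n * (\<Prod>i | i dvd Suc n. b i)"
proof -
  have "factorial_set b (Suc n) =
      (\<Prod>i=1..Suc n. b i ^ (n div i) * (if i dvd Suc n then b i else 1))"
    unfolding factorial_set_def
    by (intro prod.cong) (auto simp: div_Suc dvd_eq_mod_eq_0)
  \<comment> \<open>The extra index \<open>Suc n\<close> contributes only 1 to the first product,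
    since \<open>n div Suc n\<close> is 0.\<close>
  also have "\<dots> = factorial_set b n * (\<Prod>i=1..Suc n. if i dvd Suc n then b i else 1)"
    by (simp add: prod.distrib factorial_set_def)
  also have "(\<Prod>i=1..Suc n. if i dvd Suc n then b i else 1) = (\<Prod>i \<in> {1..Suc n} \<inter> {i. i dvd Suc n}. b i)"
    by (simp add: prod.inter_restrict)
  also have "{1..Suc n} \<inter> {i. i dvd Suc n} = {i. i dvd Suc n}"
    by (auto dest: dvd_imp_le simp: Suc_le_eq intro!: gr0I)
  finally show ?thesis .
qed

text \<open>The factor of index n occurs with exponent \<open>n div n\<close>, which is 1.\<close>

lemma dvd_factorial_set:
  assumes "n \<ge> 1"
  shows "b n dvd factorial_set b n"
  using dvd_prodI[of "{1..n}" n "\<lambda>i. b i ^ (n div i)"] assms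
  by (simp add: factorial_set_def)

theorem proposition59:
  fixes h :: "nat \<Rightarrow> nat"
  assumes "\<And>n. n \<ge> 1 \<Longrightarrow> highly_composite (h n)"
    and "\<And>n. n \<ge> 1 \<Longrightarrow> fact n dvd h n"
  shows "self_factorial (factorial_set h) \<and>
    (\<forall>k::nat. k \<ge> 1 \<longrightarrow>
      summable (\<lambda>n. 1 / real (\<Prod>i=1..Suc n. h i ^ (Suc n div i)) ^ k) \<and>
      (\<Sum>n. 1 / real (\<Prod>i=1..Suc n. h i ^ (Suc n div i)) ^ k) \<notin> \<rat>)"
proof (intro conjI allI impI)
  have h_pos: "h n > 0" if "n \<ge> 1" for n
    using assms(1)[OF that] by (simp add: highly_composite_def)
  show "self_factorial (factorial_set h)"
    unfolding self_factorial_def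
  proof
    show "fact n dvd factorial_set h n" for n
    proof (cases "n = 0")
      case True
      then show ?thesis by (simp add: factorial_set_def)
    next
      case False
      then show ?thesis using assms(2)[of n] dvd_factorial_set[of n h] by (auto intro: dvd_trans)
    qed
  qed
  fix k :: nat
  assume k: "k \<ge> 1"
  \<comment> \<open>The series starts with \<open>B\<^sub>1\<close>, so \<open>P\<close> is shifted
    by one, and the step from \<open>P n\<close> to \<open>P (Suc n)\<close> involves the divisors
    of \<open>Suc (Suc n)\<close>.\<close>
  define P where "P n = factorial_set h (Suc n) ^ k" for n
  define c where "c n = (\<Prod>i | i dvd Suc (Suc n). h i) ^ k" for n
  have P_pos: "P n > 0" for n
    by (auto simp: P_def factorial_set_def intro!: prod_pos h_pos)
  have P_step: "P (Suc n) = P n * c n" for n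
    by (simp add: P_def c_def factorial_set_Suc[of h "Suc n"] power_mult_distrib)
  have c_ge: "n \<le> c n" for n
  proof -
    let ?D = "\<Prod>i | i dvd Suc (Suc n). h i"
    have fin: "finite {i. i dvd Suc (Suc n)}" by simp
    have D_pos: "?D > 0"
      \<comment> \<open>Zero does not divide a positive number, so the unconstrained value
        \<open>h 0\<close> never enters the product.\<close>
      by (intro prod_pos ballI h_pos) (auto simp: Suc_le_eq intro!: gr0I)
    have "n \<le> fact (Suc (Suc n))"
      using fact_ge_self[of "Suc (Suc n)"] by linarith
    also have "\<dots> \<le> h (Suc (Suc n))"
      by (intro dvd_imp_le assms(2) h_pos) auto
    also have "\<dots> \<le> ?D"
      using fin D_pos by (intro dvd_imp_le dvd_prodI) auto
    also have "\<dots> \<le> c n"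
      unfolding c_def using D_pos k by (intro self_le_power) linarith+
    finally show ?thesis .
  qed
  have c_top: "filterlim c at_top sequentially"
    by (rule filterlim_at_top_mono[OF filterlim_ident]) (simp add: c_ge)
  have P_eq: "real (P n) = real (\<Prod>i=1..Suc n. h i ^ (Suc n div i)) ^ k" for n
    by (simp only: P_def factorial_set_def of_nat_power)
  show "summable (\<lambda>n. 1 / real (\<Prod>i=1..Suc n. h i ^ (Suc n div i)) ^ k)"
    and "(\<Sum>n. 1 / real (\<Prod>i=1..Suc n. h i ^ (Suc n div i)) ^ k) \<notin> \<rat>"
    using inverse_divisor_chain_sum_irrational[OF P_pos P_step c_top] unfolding P_eq by blast+
qed

end
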